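(* Let $\widetilde x$ be a simple $T$-periodic cycle of $\dot x=f(x)$, $x\in\mathbb{R}^n$. Let $\{\varepsilon_k\}_{k\in\mathbb{N}}\subset(0,1]$ converge to $0$ and let $x_k$ be a $T$-periodic solution of $\dot x=f(x)+\varepsilon_k g(t,x,\varepsilon_k)$, $k\in\mathbb{N}$, such that $x_k(t)\to\widetilde x(t)$ as $k\to\infty$. Let $D$ be a nonsingular $(n-1)\times(n-1)$ matrix and $\Delta_{\varepsilon_k}$ functions on $[0,T]$ (for all sufficiently large $k$) such that $\Delta_{\varepsilon_k}(\theta)\to0$ as $k\to\infty$ uniformly in $\theta\in[0,T]$, $x_k(\theta-\Delta_{\varepsilon_k}(\theta))\in I(\theta,B_1^{n-1}(0))$ for $\theta\in[0,T]$, and $$Z_{n-1}^*(\theta)\bigl(x_k(\theta-\Delta_{\varepsilon_k}(\theta))-\widetilde x(\theta)\bigr)=\varepsilon_k\,D\,M^\bot(\theta)+o(\varepsilon_k)$$ uniformly in $\theta\in[0,T]$. Let $\theta\in[0,T]$ be such that $M_i^\bot(\theta)=0$ for every $i\in\{1,\dots,n-1\}$. Then $$\bigl\|x_k(\theta-\Delta_{\varepsilon_k}(\theta))-\widetilde x(\theta)\bigr\|=o(\varepsilon_k).$$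
   Context: $T>0$; $f:\mathbb{R}^n\to\mathbb{R}^n$ is continuously differentiable; $g:\mathbb{R}\times\mathbb{R}^n\times[0,1]\to\mathbb{R}^n$ is continuous and $T$-periodic in the first variable. A cycle is a nonconstant periodic solution. A $T$-periodic cycle $\widetilde x$ is simple if the multiplier $+1$ of $\dot y=f'(\widetilde x(t))y$ (eigenvalue of the monodromy matrix over $[0,T]$) has algebraic multiplicity $1$. $\Omega(\cdot,t_0,\xi)$ is the solution of $\dot x=f(x)$ with value $\xi$ at time $t_0$; it is assumed that these solutions extend to $[0,T]$ for all $t_0\in[0,T]$, $\xi\in\mathbb{R}^n$. $z_1,\dots,z_{n-1}$ are linearly independent, not $T$-periodic solutions of $\dot z=-(f'(\widetilde x(t)))^*z$ with $\langle\dot{\widetilde x}(0),z_i(0)\rangle=0$, and $\widetilde z$ is the $T$-periodic solution of the same system with $\langle\dot{\widetilde x}(t),\widetilde z(t)\rangle=1$. $Z_{n-1}(t)=(z_1(t),\dots,z_{n-1}(t))$, and $M^\bot(s)=\int_{s-T}^sZ_{n-1}^*(\tau)g(\tau,\widetilde x(\tau),0)d\tau\in\mathbb{R}^{n-1}$, with components $M_i^\bot$. $Y_{n-1}(t)$ is the $n\times(n-1)$ matrix formed by the first $n-1$ columns of $\bigl((Z_{n-1}(t),\widetilde z(t))^{-1}\bigr)^*$, and $I(\theta,r)=\Omega(T,0,\widetilde x(\theta)+Y_{n-1}(\theta)r)$ for $r\in\mathbb{R}^{n-1}$. $B_1^{n-1}(0)$ is the unit ball of $\mathbb{R}^{n-1}$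 centred at $0$. $o(\varepsilon_k)$ denotes a quantity with $o(\varepsilon_k)/\varepsilon_k\to0$ as $k\to\infty$. *)

theory Defs
  imports "HOL-Analysis.Analysis" "HOL-Computational_Algebra.Polynomial"
begin

definition C1_field :: "(real ^ 'n \<Rightarrow> real ^ 'n) \<Rightarrow> bool" where
  "C1_field f \<longleftrightarrow> (\<forall>x. f differentiable (at x)) \<and> continuous_on UNIV (\<lambda>x. jacobian f (at x))"

definition periodic :: "real \<Rightarrow> (real \<Rightarrow> 'a) \<Rightarrow> bool" where
  "periodic T x \<longleftrightarrow> (\<forall>t. x (t + T) = x t)"

definition solves :: "(real \<Rightarrow> 'a \<Rightarrow> 'a) \<Rightarrow> (real \<Rightarrow> 'a::real_normed_vector) \<Rightarrow> bool" where
  "solves F x \<longleftrightarrow> (\<forall>t. (x has_vector_derivative F t (x t)) (at t))"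

definition cycle :: "('a \<Rightarrow> 'a) \<Rightarrow> (real \<Rightarrow> 'a::real_normed_vector) \<Rightarrow> bool" where
  "cycle f x \<longleftrightarrow> solves (\<lambda>t. f) x \<and> (\<exists>P>0. periodic P x) \<and> (\<exists>s t. x s \<noteq> x t)"

definition charpoly :: "real ^ 'n ^ 'n \<Rightarrow> real poly" where
  "charpoly M = det (mat [:0, 1:] - (\<chi> i j. [:M $ i $ j:]))"

definition monodromy_matrix :: "(real \<Rightarrow> real ^ 'n ^ 'n) \<Rightarrow> real \<Rightarrow> real ^ 'n ^ 'n \<Rightarrow> bool" where
  "monodromy_matrix A T M \<longleftrightarrow> (\<exists>X. solves (\<lambda>t Y. A t ** Y) X \<and> X 0 = mat 1 \<and> M = X T)"

definition simple_cycle :: "(real ^ 'n \<Rightarrow> real ^ 'n) \<Rightarrow> real \<Rightarrow> (real \<Rightarrow> real ^ 'n) \<Rightarrow> bool" where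
  "simple_cycle f T x \<longleftrightarrow> cycle f x \<and> periodic T x \<and>
     (\<exists>M. monodromy_matrix (\<lambda>t. jacobian f (at (x t))) T M \<and> order 1 (charpoly M) = 1)"

text \<open>
  In \<open>is_flow f T \<Omega>\<close>, the value \<open>\<Omega> t t0 \<xi>\<close> is constrained only for \<open>t\<close> and \<open>t0\<close> in \<open>[0, T]\<close>;
  for locally Lipschitz \<open>f\<close> it is uniquely determined there. The predicate includes the assumption
  that the solutions extend to \<open>[0, T]\<close>.
\<close>
definition is_flow ::
    "('a \<Rightarrow> 'a) \<Rightarrow> real \<Rightarrow> (real \<Rightarrow> real \<Rightarrow> 'a \<Rightarrow> 'a::real_normed_vector) \<Rightarrow> bool" where
  "is_flow f T \<Omega> \<longleftrightarrow> (\<forall>t0\<in>{0..T}. \<forall>\<xi>. \<Omega> t0 t0 \<xi> = \<xi> \<and>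
     (\<forall>t\<in>{0..T}. ((\<lambda>s. \<Omega> s t0 \<xi>) has_vector_derivative f (\<Omega> t t0 \<xi>)) (at t within {0..T})))"

definition adjoint_solution ::
    "(real ^ 'n \<Rightarrow> real ^ 'n) \<Rightarrow> (real \<Rightarrow> real ^ 'n) \<Rightarrow> (real \<Rightarrow> real ^ 'n) \<Rightarrow> bool" where
  "adjoint_solution f x z \<longleftrightarrow> solves (\<lambda>t v. - (transpose (jacobian f (at (x t))) *v v)) z"

text \<open>
  The index type \<open>'m\<close> stands for \<open>{1, \<dots>, n - 1}\<close>. Square \<open>n \<times> n\<close> matrices whose last column is
  distinguished have their columns indexed by \<open>'m option\<close>, where \<open>None\<close> is the last column.
\<close>
definition adjoint_system ::
    "(real ^ 'n \<Rightarrow> real ^ 'n) \<Rightarrow> real \<Rightarrow> (real \<Rightarrow> real ^ 'n) \<Rightarrow>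
      ('m::finite \<Rightarrow> real \<Rightarrow> real ^ 'n) \<Rightarrow> (real \<Rightarrow> real ^ 'n) \<Rightarrow> bool" where
  "adjoint_system f T x z zt \<longleftrightarrow>
     (\<forall>i. adjoint_solution f x (z i)) \<and>
     (\<forall>c :: 'm \<Rightarrow> real. (\<forall>t. (\<Sum>i\<in>UNIV. c i *\<^sub>R z i t) = 0) \<longrightarrow> (\<forall>i. c i = 0)) \<and>
     (\<forall>i. \<not> periodic T (z i)) \<and>
     (\<forall>i. vector_derivative x (at 0) \<bullet> z i 0 = 0) \<and>
     adjoint_solution f x zt \<and> periodic T zt \<and>
     (\<forall>t. vector_derivative x (at t) \<bullet> zt t = 1)"

definition Zmat :: "('m::finite \<Rightarrow> real \<Rightarrow> real ^ 'n) \<Rightarrow> real \<Rightarrow> real ^ 'm ^ 'n" where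
  "Zmat z t = (\<chi> j i. z i t $ j)"

definition Zfull ::
    "('m::finite \<Rightarrow> real \<Rightarrow> real ^ 'n) \<Rightarrow> (real \<Rightarrow> real ^ 'n) \<Rightarrow> real \<Rightarrow> real ^ ('m option) ^ 'n" where
  "Zfull z zt t = (\<chi> j k. (case k of Some i \<Rightarrow> z i t | None \<Rightarrow> zt t) $ j)"

definition Ymat ::
    "('m::finite \<Rightarrow> real \<Rightarrow> real ^ 'n) \<Rightarrow> (real \<Rightarrow> real ^ 'n) \<Rightarrow> real \<Rightarrow> real ^ 'm ^ 'n" where
  "Ymat z zt t = (\<chi> j i. transpose (matrix_inv (Zfull z zt t)) $ j $ Some i)"

definition Mperp ::
    "(real \<Rightarrow> real ^ 'n \<Rightarrow> real \<Rightarrow> real ^ 'n) \<Rightarrow> real \<Rightarrow> (real \<Rightarrow> real ^ 'n) \<Rightarrow>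
      ('m::finite \<Rightarrow> real \<Rightarrow> real ^ 'n) \<Rightarrow> real \<Rightarrow> real ^ 'm" where
  "Mperp g T x z s = integral {s - T..s} (\<lambda>\<tau>. transpose (Zmat z \<tau>) *v g \<tau> (x \<tau>) 0)"

definition Imap ::
    "(real \<Rightarrow> real \<Rightarrow> real ^ 'n \<Rightarrow> real ^ 'n) \<Rightarrow> real \<Rightarrow> (real \<Rightarrow> real ^ 'n) \<Rightarrow>
      ('m::finite \<Rightarrow> real \<Rightarrow> real ^ 'n) \<Rightarrow> (real \<Rightarrow> real ^ 'n) \<Rightarrow> real \<Rightarrow> real ^ 'm \<Rightarrow> real ^ 'n" where
  "Imap \<Omega> T x z zt \<theta> r = \<Omega> T 0 (x \<theta> + Ymat z zt \<theta> *v r)"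

end

theory Submission
  imports Defs
begin

text \<open>
  Put \<open>v k = x k (\<theta> - \<Delta> k \<theta>) - xt \<theta>\<close>. Since \<open>Mperp\<close> vanishes at \<open>\<theta>\<close>, the asymptotic expansion says that the
  components \<open>z i \<theta> \<bullet> v k\<close> are \<open>o(\<epsilon> k)\<close>. These are \<open>n - 1\<close> of the \<open>n\<close> coordinates of \<open>v k\<close>; the missing
  one is the component along the cycle. It is controlled because \<open>x k (\<theta> - \<Delta> k \<theta>)\<close> lies on the surface
  \<open>Imap \<Omega> T xt z zt \<theta>\<close>, the image under the time-\<open>T\<close> map of an \<open>(n - 1)\<close>-dimensional section through
  \<open>xt \<theta>\<close>. This surface passes through \<open>xt \<theta>\<close> and is transversal to the cycle there, so near \<open>xt \<theta>\<close>
  every point \<open>xt \<theta> + v\<close> of it satisfies \<open>\<bar>v\<bar> \<le> C \<bar>Z\<^sup>* v\<bar>\<close>, where \<open>Z = Zmat z \<theta>\<close>; this is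
  \<open>section_transversality\<close>.

  Transversality comes from the adjoint equation: the inner product of \<open>z i\<close> with a solution of the
  variational equation is constant, so, to first order, \<open>z i (\<theta> + T)\<close> reads off from \<open>v\<close> the coordinates
  \<open>r\<close> of the initial point on the section (\<open>Ymat_dual\<close>), and \<open>z i (\<theta> + T)\<close> is a combination of the
  \<open>z j \<theta>\<close> (\<open>shifted_z_bound\<close>). Differentiability of the flow is avoided: the linearization of \<open>f\<close> along
  the cycle together with Gronwall estimates in both time directions gives the comparison directly.
  The estimates start from the smallness of the final difference \<open>v\<close>, and the smallness of \<open>r\<close> is a
  consequence of them.

  That \<open>v k\<close> tends to \<open>0\<close> at all follows from the pointwise convergence of \<open>x k\<close>, since the perturbed
  fields are bounded near \<open>xt \<theta>\<close> uniformly in \<open>k\<close> (\<open>displaced_solutions_tendsto\<close>).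
\<close>

section \<open>Growth of solutions\<close>

text \<open>
  The continuity argument behind all local estimates: if \<open>\<phi> \<le> \<rho>\<close> up to time \<open>s\<close> excludes
  \<open>\<phi> s = \<rho>\<close>, then there is no first time at which \<open>\<rho>\<close> is attained.
\<close>
lemma first_exit:
  fixes \<phi> :: "real \<Rightarrow> real"
  assumes cont: "continuous_on {a..b} \<phi>" and start: "\<phi> a < \<rho>"
    and no_exit: "\<And>s. \<lbrakk>a \<le> s; s \<le> b; \<And>t. \<lbrakk>a \<le> t; t \<le> s\<rbrakk> \<Longrightarrow> \<phi> t \<le> \<rho>\<rbrakk> \<Longrightarrow> \<phi> s \<noteq> \<rho>"
    and t: "t \<in> {a..b}"
  shows "\<phi> t < \<rho>"
proof (rule ccontr)
  assume "\<not> \<phi> t < \<rho>"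
  define H where "H = {s \<in> {a..b}. \<phi> s = \<rho>}"
  have hit: "\<exists>s\<in>H. s \<le> t'" if "t' \<in> {a..b}" "\<rho> \<le> \<phi> t'" for t'
  proof -
    have "\<exists>s\<ge>a. s \<le> t' \<and> \<phi> s = \<rho>"
      using that start continuous_on_subset[OF cont, of "{a..t'}"]
      by (intro IVT') auto
    then show ?thesis using that by (auto simp: H_def)
  qed
  have "H \<noteq> {}" using hit[OF t] \<open>\<not> \<phi> t < \<rho>\<close> by auto
  moreover have "compact H"
    unfolding compact_eq_bounded_closed
  proof
    show "bounded H" by (rule bounded_subset[of "{a..b}"]) (auto simp: H_def)
    show "closed H" unfolding H_def
      by (rule continuous_closed_preimage_constant[OF cont]) simp
  qed
  ultimately obtain s where s: "s \<in> H" "\<And>s'. s' \<in> H \<Longrightarrow> s \<le> s'"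
    using compact_attains_inf[of H] by auto
  have "\<phi> t' \<le> \<rho>" if "a \<le> t'" "t' \<le> s" for t'
  proof (rule ccontr)
    assume "\<not> \<phi> t' \<le> \<rho>"
    then have "t' \<in> {a..b}" "\<rho> \<le> \<phi> t'"
      using that s(1) by (auto simp: H_def)
    from hit[OF this] obtain s' where "s' \<in> H" "s' \<le> t'" by blast
    then have "t' = s" using s(2)[of s'] that by auto
    then show False using \<open>\<not> \<phi> t' \<le> \<rho>\<close> s(1) by (auto simp: H_def)
  qed
  then show False using no_exit[of s] s(1) by (auto simp: H_def)
qed

text \<open>The function \<open>\<bar>u\<bar>\<^sup>2 exp (- 2 L t)\<close> has nonpositive derivative.\<close>
lemma gronwall_forward:
  fixes u :: "real \<Rightarrow> 'a::real_inner"
  assumes "a \<le> b"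
    and deriv: "\<And>t. t \<in> {a..b} \<Longrightarrow> (u has_vector_derivative u' t) (at t within {a..b})"
    and bound: "\<And>t. t \<in> {a..b} \<Longrightarrow> norm (u' t) \<le> L * norm (u t)"
  shows "norm (u b) \<le> exp (L * (b - a)) * norm (u a)"
proof -
  define \<phi> where "\<phi> t = (u t \<bullet> u t) * exp (- (2 * L * t))" for t
  have "\<phi> b \<le> \<phi> a"
  proof (rule DERIV_nonpos_imp_decreasing_open[OF \<open>a \<le> b\<close>])
    have "continuous_on {a..b} u"
      by (rule continuous_on_vector_derivative[OF deriv])
    then show "continuous_on {a..b} \<phi>"
      unfolding \<phi>_def by (intro continuous_intros)
  next
    fix t assume t: "a < t" "t < b"
    then have at: "at t within {a..b} = at t"
      by (simp add: at_within_Icc_at)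
    have du: "(u has_vector_derivative u' t) (at t)"
      using deriv[of t] t by (simp add: at)
    have "((\<lambda>t. u t \<bullet> u t) has_vector_derivative (u t \<bullet> u' t + u' t \<bullet> u t)) (at t)"
      using du by (rule bounded_bilinear.has_vector_derivative[OF bounded_bilinear_inner, OF _ du])
    then have "((\<lambda>t. u t \<bullet> u t) has_field_derivative (u t \<bullet> u' t + u' t \<bullet> u t)) (at t)"
      by (simp add: has_real_derivative_iff_has_vector_derivative)
    then have "(\<phi> has_field_derivative
        (2 * (u t \<bullet> u' t) - 2 * L * (u t \<bullet> u t)) * exp (- (2 * L * t))) (at t)"
      unfolding \<phi>_def
      by (auto intro!: derivative_eq_intros simp: inner_commute algebra_simps)
    moreover have "u t \<bullet> u' t \<le> L * (u t \<bullet> u t)"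
    proof -
      have "u t \<bullet> u' t \<le> norm (u t) * norm (u' t)" by (rule norm_cauchy_schwarz)
      also have "\<dots> \<le> norm (u t) * (L * norm (u t))"
        using bound[of t] t by (intro mult_left_mono) auto
      finally show ?thesis by (simp add: dot_square_norm power2_eq_square mult_ac)
    qed
    ultimately show "\<exists>y. (\<phi> has_field_derivative y) (at t) \<and> y \<le> 0"
      by (intro exI[of _ "(2 * (u t \<bullet> u' t) - 2 * L * (u t \<bullet> u t)) * exp (- (2 * L * t))"])
        (auto simp: mult_le_0_iff)
  qed
  then have "(norm (u b))\<^sup>2 * exp (- (2 * L * b)) * exp (2 * L * b)
      \<le> (norm (u a))\<^sup>2 * exp (- (2 * L * a)) * exp (2 * L * b)"
    by (intro mult_right_mono) (auto simp: \<phi>_def dot_square_norm)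
  also have "\<dots> = (exp (L * (b - a)) * norm (u a))\<^sup>2"
    by (simp add: power_mult_distrib mult.assoc flip: exp_add exp_double)
      (simp add: algebra_simps)
  finally have "(norm (u b))\<^sup>2 \<le> (exp (L * (b - a)) * norm (u a))\<^sup>2"
    by (simp add: mult.assoc flip: exp_add)
  then show ?thesis by (rule power2_le_imp_le) simp
qed

text \<open>The endpoints \<open>p\<close> and \<open>q\<close> come in either order; the case \<open>q < p\<close> is reduced to the other by
  reversing time.\<close>
lemma gronwall:
  fixes u :: "real \<Rightarrow> 'a::real_inner"
  assumes deriv: "\<And>t. t \<in> {a..b} \<Longrightarrow> (u has_vector_derivative u' t) (at t within {a..b})"
    and bound: "\<And>t. t \<in> {a..b} \<Longrightarrow> norm (u' t) \<le> L * norm (u t)"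
    and "0 \<le> L" and p: "p \<in> {a..b}" and q: "q \<in> {a..b}"
  shows "norm (u q) \<le> exp (L * (b - a)) * norm (u p)"
proof -
  have "norm (u q) \<le> exp (L * \<bar>q - p\<bar>) * norm (u p)"
  proof (cases "p \<le> q")
    case True
    have "norm (u q) \<le> exp (L * (q - p)) * norm (u p)"
    proof (rule gronwall_forward[OF True])
      show "(u has_vector_derivative u' t) (at t within {p..q})" if "t \<in> {p..q}" for t
        using that p q by (intro has_vector_derivative_within_subset[OF deriv]) auto
      show "norm (u' t) \<le> L * norm (u t)" if "t \<in> {p..q}" for t
        using that p q by (intro bound) auto
    qed
    then show ?thesis using True by simp
  next
    case False
    have "norm (u (- (- q))) \<le> exp (L * (- q - (- p))) * norm (u (- (- p)))"
    proof (rule gronwall_forward[where u = "\<lambda>t. u (- t)" and u' = "\<lambda>t. - u' (- t)"])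
      show "- p \<le> - q" using False by simp
      fix t assume t: "t \<in> {- p..- q}"
      have "(u has_vector_derivative u' (- t)) (at (- t) within uminus ` {- p..- q})"
        using t p q by (intro has_vector_derivative_within_subset[OF deriv]) auto
      moreover have "(uminus has_vector_derivative (- 1::real)) (at t within {- p..- q})"
        by (auto intro!: derivative_eq_intros)
      ultimately show "((\<lambda>t. u (- t)) has_vector_derivative - u' (- t)) (at t within {- p..- q})"
        using vector_diff_chain_within[of uminus "-1" t "{-p..-q}" u] by (simp add: o_def)
      show "norm (- u' (- t)) \<le> L * norm (u (- t))"
        using bound[of "- t"] t p q by auto
    qed
    then show ?thesis using False by simp
  qed
  also have "\<dots> \<le> exp (L * (b - a)) * norm (u p)"
    using p q \<open>0 \<le> L\<close> by (intro mult_right_mono) (auto intro!: mult_left_mono)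
  finally show ?thesis .
qed

text \<open>
  The growth bound is assumed only as long as \<open>u\<close> stays in the \<open>\<rho>\<close>-tube. A terminal value that is
  small enough keeps \<open>u\<close> in the tube on the whole interval, so that \<open>gronwall\<close> becomes applicable.
\<close>
lemma gronwall_backward_tube:
  fixes u :: "real \<Rightarrow> 'a::real_inner"
  assumes deriv: "\<And>t. t \<in> {a..b} \<Longrightarrow> (u has_vector_derivative u' t) (at t within {a..b})"
    and bound: "\<And>t. \<lbrakk>t \<in> {a..b}; norm (u t) \<le> \<rho>\<rbrakk> \<Longrightarrow> norm (u' t) \<le> L * norm (u t)"
    and "0 \<le> L" and small: "exp (L * (b - a)) * norm (u b) < \<rho>" and t: "t \<in> {a..b}"
  shows "norm (u t) < \<rho>"
proof -
  have "norm (u (- (- t))) < \<rho>"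
  proof (rule first_exit[where \<phi> = "\<lambda>t. norm (u (- t))"])
    have "continuous_on {a..b} u"
      by (rule continuous_on_vector_derivative[OF deriv])
    then show "continuous_on {- b..- a} (\<lambda>t. norm (u (- t)))"
      by (intro continuous_on_norm continuous_on_compose2[of "{a..b}" u "{- b..- a}" uminus]
          continuous_on_minus continuous_on_id) auto
    show "- t \<in> {- b..- a}" using t by auto
    have "norm (u b) \<le> exp (L * (b - a)) * norm (u b)"
      using t \<open>0 \<le> L\<close> by (simp add: mult_le_cancel_right1)
    then show "norm (u (- (- b))) < \<rho>" using small by simp
    fix s assume s: "- b \<le> s" "s \<le> - a"
      and tube: "\<And>t. \<lbrakk>- b \<le> t; t \<le> s\<rbrakk> \<Longrightarrow> norm (u (- t)) \<le> \<rho>"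
    have "norm (u (- s)) \<le> exp (L * (b - (- s))) * norm (u b)"
    proof (rule gronwall[of "- s" b u u' L b "- s"])
      show "(u has_vector_derivative u' t) (at t within {- s..b})" if "t \<in> {- s..b}" for t
        using that s by (intro has_vector_derivative_within_subset[OF deriv]) auto
      show "norm (u' t) \<le> L * norm (u t)" if "t \<in> {- s..b}" for t
        using that s tube[of "- t"] by (intro bound) auto
    qed (use s \<open>0 \<le> L\<close> in auto)
    also have "\<dots> \<le> exp (L * (b - a)) * norm (u b)"
      using s \<open>0 \<le> L\<close> by (intro mult_right_mono) (auto intro!: mult_left_mono)
    finally show "norm (u (- s)) \<noteq> \<rho>" using small by linarith
  qed
  then show ?thesis by simp
qed

section \<open>Continuously differentiable vector fields\<close>

lemma norm_matrix_vector_le: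
  fixes A :: "real ^ 'n ^ 'm"
  shows "norm (A *v v) \<le> norm A * norm v"
proof -
  have "norm (A *v v) \<le> L2_set (\<lambda>i. norm (A $ i) * norm v) UNIV"
    unfolding norm_vec_def[of "A *v v"]
    by (intro L2_set_mono) (auto simp: matrix_vector_mul_component Cauchy_Schwarz_ineq2)
  also have "\<dots> = norm A * norm v"
    by (simp add: norm_vec_def[of A] L2_set_left_distrib)
  finally show ?thesis .
qed

lemma norm_transpose_vector_le:
  fixes A :: "real ^ 'n ^ 'm"
  shows "norm (transpose A *v v) \<le> norm A * norm v"
proof (cases "transpose A *v v = 0")
  case False
  have "norm (transpose A *v v) * norm (transpose A *v v) = v \<bullet> (A *v (transpose A *v v))"
    by (metis dot_lmul_matrix dot_square_norm power2_eq_square vector_transpose_matrix transpose_transpose)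
  also have "\<dots> \<le> norm v * (norm A * norm (transpose A *v v))"
    by (meson norm_cauchy_schwarz norm_matrix_vector_le mult_left_mono norm_ge_zero order_trans)
  finally show ?thesis using False by (simp add: mult_ac)
qed simp

lemma C1_field_has_derivative:
  assumes "C1_field f"
  shows "(f has_derivative (\<lambda>h. jacobian f (at x) *v h)) (at x within S)"
  using assms unfolding C1_field_def
  by (meson has_derivative_at_withinI jacobian_works)

text \<open>
  The Jacobian is uniformly continuous on a ball containing a unit neighbourhood of \<open>K\<close>, hence its
  oscillation on the segment from \<open>y\<close> to \<open>y + d\<close> is small uniformly in \<open>y\<close>.
\<close>
lemma C1_field_uniform_linearization:
  fixes f :: "real ^ 'n \<Rightarrow> real ^ 'n"
  assumes f: "C1_field f" and K: "compact K" and "0 < \<eta>"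
  obtains \<rho> where "0 < \<rho>"
    "\<And>y d. \<lbrakk>y \<in> K; norm d \<le> \<rho>\<rbrakk> \<Longrightarrow>
      norm (f (y + d) - f y - jacobian f (at y) *v d) \<le> \<eta> * norm d"
proof -
  define J where "J x = jacobian f (at x)" for x
  obtain R where R: "\<And>y. y \<in> K \<Longrightarrow> norm y \<le> R"
    using compact_imp_bounded[OF K] by (auto simp: bounded_iff)
  have "continuous_on (cball 0 (R + 1)) J"
    using f continuous_on_subset unfolding C1_field_def J_def by blast
  then have "uniformly_continuous_on (cball 0 (R + 1)) J"
    by (rule compact_uniformly_continuous) simp
  then obtain \<delta> where "0 < \<delta>" and \<delta>: "\<And>x y. \<lbrakk>norm x \<le> R + 1; norm y \<le> R + 1; dist y x < \<delta>\<rbrakk>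
      \<Longrightarrow> dist (J y) (J x) < \<eta>"
    using \<open>0 < \<eta>\<close> unfolding uniformly_continuous_on_def by (force simp: dist_norm)
  show ?thesis
  proof (rule that[of "min (\<delta> / 2) 1"])
    show "0 < min (\<delta> / 2) 1" using \<open>0 < \<delta>\<close> by simp
    fix y d :: "real ^ 'n" assume y: "y \<in> K" and d: "norm d \<le> min (\<delta> / 2) 1"
    have "norm (f (y + d) - f y - J y *v (y + d - y)) \<le> norm (y + d - y) * \<eta>"
    proof (rule differentiable_bound_linearization[where S = "cball y (norm d)"
            and f' = "\<lambda>x. (*v) (J x)"])
      show "y + t *\<^sub>R (y + d - y) \<in> cball y (norm d)" if "t \<in> {0..1}" for t
        using that by (simp add: dist_norm mult_left_le_one_le)
      show "(f has_derivative (*v) (J x)) (at x within cball y (norm d))" for x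
        unfolding J_def by (rule C1_field_has_derivative[OF f])
      show "y \<in> cball y (norm d)" by simp
      fix x assume "x \<in> cball y (norm d)"
      then have xy: "norm (x - y) \<le> norm d" by (simp add: dist_norm norm_minus_commute)
      have "norm x \<le> norm y + norm (x - y)" by norm
      then have "dist (J x) (J y) < \<eta>"
        using xy d R[OF y] \<open>0 < \<delta>\<close> by (intro \<delta>) (auto simp: dist_norm)
      then have J: "norm (J x - J y) \<le> \<eta>" by (simp add: dist_norm)
      show "onorm ((*v) (J x) - (*v) (J y)) \<le> \<eta>"
      proof (rule onorm_le)
        fix v
        have "((*v) (J x) - (*v) (J y)) v = (J x - J y) *v v"
          by (simp add: matrix_vector_mult_diff_rdistrib)
        then show "norm (((*v) (J x) - (*v) (J y)) v) \<le> \<eta> * norm v"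
          using norm_matrix_vector_le[of "J x - J y" v] J
          by (metis mult_right_mono norm_ge_zero order_trans)
      qed
    qed
    then show "norm (f (y + d) - f y - jacobian f (at y) *v d) \<le> \<eta> * norm d"
      by (simp add: J_def mult.commute)
  qed
qed

section \<open>The adjoint frame and its dual basis\<close>

lemma matrix_inv_two_sided:
  fixes A :: "'a::semiring_1 ^ 'n ^ 'm"
  assumes "invertible A"
  shows "A ** matrix_inv A = mat 1" "matrix_inv A ** A = mat 1"
  using someI_ex[OF assms[unfolded invertible_def]] by (auto simp: matrix_inv_def)

lemma Zmat_transpose_nth: "(transpose (Zmat z t) *v v) $ i = z i t \<bullet> v"
  by (simp add: Zmat_def transpose_def matrix_vector_mult_def inner_vec_def)

lemma Zfull_transpose_nth: "(transpose (Zfull z zt t) *v v) $ Some i = z i t \<bullet> v"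
  by (simp add: Zfull_def transpose_def matrix_vector_mult_def inner_vec_def)

lemma Zfull_mult: "Zfull z zt t *v c = (\<Sum>i\<in>UNIV. c $ Some i *\<^sub>R z i t) + c $ None *\<^sub>R zt t"
  by (simp add: Zfull_def matrix_vector_mult_def vec_eq_iff UNIV_option_conv sum.reindex
      mult.commute)

text \<open>
  The columns of \<open>Ymat\<close> belong to the basis dual to the columns of \<open>Zfull\<close>. Hence pairing with the
  \<open>z i\<close> recovers the coordinates of a point of the section.
\<close>
lemma Ymat_dual:
  assumes "invertible (Zfull z zt t)"
  shows "z i t \<bullet> (Ymat z zt t *v r) = r $ i"
proof -
  define r' :: "real ^ ('a option)" where "r' = (\<chi> k. case k of Some i \<Rightarrow> r $ i | None \<Rightarrow> 0)"
  have "Ymat z zt t *v r = transpose (matrix_inv (Zfull z zt t)) *v r'"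
    by (simp add: Ymat_def r'_def matrix_vector_mult_def vec_eq_iff UNIV_option_conv sum.reindex)
  then have "transpose (Zfull z zt t) *v (Ymat z zt t *v r)
      = transpose (matrix_inv (Zfull z zt t) ** Zfull z zt t) *v r'"
    by (simp only: matrix_vector_mul_assoc matrix_transpose_mul)
  then have "transpose (Zfull z zt t) *v (Ymat z zt t *v r) = r'"
    by (simp only: matrix_inv_two_sided(2)[OF assms] transpose_mat matrix_vector_mul_lid)
  then show ?thesis
    by (simp add: r'_def flip: Zfull_transpose_nth[of z zt t])
qed

lemma adjoint_solution_sum:
  assumes "\<And>i. adjoint_solution f x (z i)"
  shows "adjoint_solution f x (\<lambda>t. \<Sum>i\<in>I. c i *\<^sub>R z i t)"
proof -
  have deriv: "((\<lambda>t. \<Sum>i\<in>I. c i *\<^sub>R z i t) has_vector_derivative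
      (\<Sum>i\<in>I. c i *\<^sub>R - (transpose (jacobian f (at (x t))) *v z i t))) (at t)" for t
    using assms unfolding adjoint_solution_def solves_def
    by (auto intro!: derivative_eq_intros)
  have linear: "(\<Sum>i\<in>I. c i *\<^sub>R - (A *v z i t)) = - (A *v (\<Sum>i\<in>I. c i *\<^sub>R z i t))"
    for t and A :: "real ^ 'b ^ 'b"
    by (simp add: sum_negf vec.sum scalar_mult_eq_scaleR[symmetric] vec.scale)
  show ?thesis unfolding adjoint_solution_def solves_def
    using deriv by (simp only: linear) blast
qed

lemma solves_imp_continuous:
  assumes "solves F x"
  shows "continuous_on S x"
  using assms unfolding solves_def
  by (meson continuous_at_imp_continuous_on has_vector_derivative_continuous)

lemma jacobian_bounded_along:
  fixes f :: "real ^ 'n \<Rightarrow> real ^ 'n"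
  assumes "C1_field f" and "continuous_on {a..b} x"
  obtains L where "0 \<le> L" "\<And>t. t \<in> {a..b::real} \<Longrightarrow> norm (jacobian f (at (x t))) \<le> L"
proof -
  have "continuous_on {a..b} (\<lambda>t. jacobian f (at (x t)))"
    using assms unfolding C1_field_def
    by (auto intro: continuous_on_compose2[of UNIV "\<lambda>y. jacobian f (at y)"])
  then have "bounded ((\<lambda>t. jacobian f (at (x t))) ` {a..b})"
    by (intro compact_imp_bounded compact_continuous_image) auto
  then obtain L where L: "\<forall>t\<in>{a..b}. norm (jacobian f (at (x t))) \<le> L"
    by (auto simp: bounded_iff)
  show thesis
    by (rule that[of "max 0 L"]) (use L in \<open>auto intro: max.coboundedI2\<close>)
qed

lemma adjoint_solution_zero:
  fixes f :: "real ^ 'n \<Rightarrow> real ^ 'n"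
  assumes f: "C1_field f" and x: "continuous_on UNIV x"
    and w: "adjoint_solution f x w" and zero: "w p = 0"
  shows "w q = 0"
proof -
  define a b where "a = min p q" and "b = max p q"
  obtain L where L: "0 \<le> L" "\<And>t. t \<in> {a..b} \<Longrightarrow> norm (jacobian f (at (x t))) \<le> L"
    by (rule jacobian_bounded_along[OF f continuous_on_subset[OF x subset_UNIV], of a b]) blast
  have "norm (w q) \<le> exp (L * (b - a)) * norm (w p)"
  proof (rule gronwall[where u' = "\<lambda>t. - (transpose (jacobian f (at (x t))) *v w t)"])
    show "(w has_vector_derivative - (transpose (jacobian f (at (x t))) *v w t))
        (at t within {a..b})" for t
      using w unfolding adjoint_solution_def solves_def
      by (blast intro: has_vector_derivative_at_within)
    show "norm (- (transpose (jacobian f (at (x t))) *v w t)) \<le> L * norm (w t)"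
      if "t \<in> {a..b}" for t
      unfolding norm_minus_cancel
      by (rule order_trans[OF norm_transpose_vector_le mult_right_mono[OF L(2)[OF that] norm_ge_zero]])
  qed (use L in \<open>auto simp: a_def b_def\<close>)
  then show ?thesis using zero by simp
qed

lemma inner_has_derivative:
  fixes u w :: "real \<Rightarrow> 'a::real_inner"
  assumes "(u has_vector_derivative u') (at t within S)"
    and "(w has_vector_derivative w') (at t within S)"
  shows "((\<lambda>t. u t \<bullet> w t) has_vector_derivative (u t \<bullet> w' + u' \<bullet> w t)) (at t within S)"
  by (rule bounded_bilinear.has_vector_derivative[OF bounded_bilinear_inner assms])

text \<open>
  The velocity \<open>f (x t)\<close> solves the variational equation, and solutions of a linear equation and of its
  adjoint have constant inner product.
\<close>
lemma adjoint_solution_inner_velocity: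
  fixes f :: "real ^ 'n \<Rightarrow> real ^ 'n"
  assumes f: "C1_field f" and x: "solves (\<lambda>t. f) x" and w: "adjoint_solution f x w"
  shows "f (x t) \<bullet> w t = f (x s) \<bullet> w s"
proof -
  have "((\<lambda>t. f (x t) \<bullet> w t) has_vector_derivative 0) (at t)" for t
  proof -
    have dx: "(x has_vector_derivative f (x t)) (at t)"
      using x by (simp add: solves_def)
    have "((\<lambda>t. f (x t)) has_vector_derivative jacobian f (at (x t)) *v f (x t)) (at t)"
      using vector_derivative_diff_chain_within[OF dx C1_field_has_derivative[OF f]]
      by (simp add: o_def)
    moreover have "(w has_vector_derivative - (transpose (jacobian f (at (x t))) *v w t)) (at t)"
      using w by (simp add: adjoint_solution_def solves_def)
    ultimately have "((\<lambda>t. f (x t) \<bullet> w t) has_vector_derivative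
        (f (x t) \<bullet> - (transpose (jacobian f (at (x t))) *v w t)
          + (jacobian f (at (x t)) *v f (x t)) \<bullet> w t)) (at t)"
      by (rule inner_has_derivative)
    moreover have "f (x t) \<bullet> (transpose (jacobian f (at (x t))) *v w t)
        = (jacobian f (at (x t)) *v f (x t)) \<bullet> w t"
      by (metis dot_lmul_matrix inner_commute vector_transpose_matrix transpose_transpose)
    ultimately show ?thesis by simp
  qed
  then show ?thesis
    using has_vector_derivative_zero_constant[of UNIV "\<lambda>t. f (x t) \<bullet> w t"]
    by (metis UNIV_I convex_UNIV)
qed

locale cycle_with_adjoint =
  fixes T :: real
    and f :: "real ^ 'n \<Rightarrow> real ^ 'n"
    and xt zt :: "real \<Rightarrow> real ^ 'n"
    and z :: "'m::finite \<Rightarrow> real \<Rightarrow> real ^ 'n"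
  assumes dim: "CARD('n) = CARD('m) + 1"
    and T: "T > 0"
    and f: "C1_field f"
    and xt: "solves (\<lambda>t. f) xt" "periodic T xt"
    and adj: "adjoint_system f T xt z zt"
begin

lemma velocity: "vector_derivative xt (at t) = f (xt t)"
  using xt(1) unfolding solves_def by (blast intro: vector_derivative_at)

lemma z_adjoint: "adjoint_solution f xt (z i)"
  using adj by (simp add: adjoint_system_def)

lemma velocity_orthogonal: "f (xt t) \<bullet> z i t = 0"
  using adj adjoint_solution_inner_velocity[OF f xt(1) z_adjoint, of t i 0]
  by (simp add: adjoint_system_def velocity)

lemma velocity_zt: "f (xt t) \<bullet> zt t = 1"
  using adj by (simp add: adjoint_system_def velocity)

lemma xt_continuous: "continuous_on S xt"
  by (rule solves_imp_continuous[OF xt(1)])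

text \<open>
  Independence as functions becomes independence at each time, because a solution of the linear
  adjoint equation that vanishes once vanishes identically.
\<close>
lemma z_independent_at:
  assumes "(\<Sum>i\<in>UNIV. c i *\<^sub>R z i t) = 0"
  shows "c i = 0"
proof -
  have "(\<Sum>i\<in>UNIV. c i *\<^sub>R z i s) = 0" for s
    by (rule adjoint_solution_zero[where w = "\<lambda>s. \<Sum>i\<in>UNIV. c i *\<^sub>R z i s",
          OF f xt_continuous adjoint_solution_sum[OF z_adjoint] assms])
  then show ?thesis using adj by (auto simp: adjoint_system_def)
qed

text \<open>
  Pairing a vanishing combination of the columns with the velocity isolates the coefficient of \<open>zt\<close>;
  the remaining coefficients vanish by independence of the \<open>z i t\<close>.
\<close>
lemma Zfull_invertible: "invertible (Zfull z zt t)"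
proof -
  have "c = 0" if c: "Zfull z zt t *v c = 0" for c
  proof -
    have "0 = f (xt t) \<bullet> (Zfull z zt t *v c)" using c by simp
    also have "\<dots> = c $ None"
      by (simp add: Zfull_mult inner_add_right inner_sum_right velocity_orthogonal velocity_zt)
    finally have none: "c $ None = 0" by simp
    then have "c $ Some i = 0" for i
      using z_independent_at[of "\<lambda>i. c $ Some i" t i] c by (simp add: Zfull_mult)
    with none show "c = 0" by (metis not_None_eq vec_eq_iff zero_index)
  qed
  then have inj: "inj ((*v) (Zfull z zt t))"
    by (simp add: vec.inj_iff_eq_0)
  have "surj ((*v) (Zfull z zt t))"
    using dim inj by (intro linear_injective_imp_surjective) auto
  with inj show ?thesis
    using matrix_left_invertible_injective[of "Zfull z zt t"]
      matrix_right_invertible_surjective[of "Zfull z zt t"]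
    by (metis invertible_def matrix_mul_assoc matrix_mul_lid matrix_mul_rid)
qed

text \<open>
  The columns of the invertible matrix \<open>Zfull\<close> span the whole space, and the coefficient of \<open>zt\<close> in a
  combination is its inner product with the velocity.
\<close>
lemma orthogonal_in_span:
  assumes "f (xt t) \<bullet> w = 0"
  obtains c where "w = (\<Sum>i\<in>UNIV. c i *\<^sub>R z i t)"
proof -
  define c where "c = matrix_inv (Zfull z zt t) *v w"
  have w: "w = Zfull z zt t *v c"
    by (simp add: c_def matrix_vector_mul_assoc matrix_inv_two_sided(1)[OF Zfull_invertible])
  have "c $ None = f (xt t) \<bullet> w"
    unfolding w
    by (simp add: Zfull_mult inner_add_right inner_sum_right velocity_orthogonal velocity_zt)
  then show thesis
    using that[of "\<lambda>i. c $ Some i"] w assms by (simp add: Zfull_mult)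
qed

text \<open>
  One period later, the \<open>z i\<close> are orthogonal to the same velocity vector, so the \<open>z i (t + T)\<close> are
  combinations of the \<open>z j t\<close>. This replaces periodicity of the \<open>z i\<close>.
\<close>
lemma shifted_z_bound:
  obtains C where "0 \<le> C"
    "\<And>v. (\<Sum>i\<in>UNIV. \<bar>z i (t + T) \<bullet> v\<bar>) \<le> C * norm (transpose (Zmat z t) *v v)"
proof -
  have "f (xt t) \<bullet> z i (t + T) = 0" for i
    using velocity_orthogonal[of "t + T" i] xt(2) by (simp add: periodic_def)
  then have "\<exists>c. z i (t + T) = (\<Sum>j\<in>UNIV. c j *\<^sub>R z j t)" for i
    by (metis orthogonal_in_span[of t "z i (t + T)" for i])
  then obtain c where c: "\<And>i. z i (t + T) = (\<Sum>j\<in>UNIV. c i j *\<^sub>R z j t)"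
    by metis
  show thesis
  proof (rule that[of "\<Sum>i\<in>UNIV. \<Sum>j\<in>UNIV. \<bar>c i j\<bar>"])
    show "0 \<le> (\<Sum>i\<in>UNIV. \<Sum>j\<in>UNIV. \<bar>c i j\<bar>)" by (simp add: sum_nonneg)
    fix v
    have "\<bar>z i (t + T) \<bullet> v\<bar> \<le> (\<Sum>j\<in>UNIV. \<bar>c i j\<bar> * norm (transpose (Zmat z t) *v v))" for i
    proof -
      have "\<bar>z i (t + T) \<bullet> v\<bar> \<le> (\<Sum>j\<in>UNIV. \<bar>c i j * (z j t \<bullet> v)\<bar>)"
        unfolding c by (simp add: inner_sum_left sum_abs)
      also have "\<dots> \<le> (\<Sum>j\<in>UNIV. \<bar>c i j\<bar> * norm (transpose (Zmat z t) *v v))"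
        using component_le_norm_cart[of "transpose (Zmat z t) *v v"]
        unfolding Zmat_transpose_nth abs_mult by (intro sum_mono mult_left_mono) auto
      finally show ?thesis .
    qed
    then show "(\<Sum>i\<in>UNIV. \<bar>z i (t + T) \<bullet> v\<bar>)
        \<le> (\<Sum>i\<in>UNIV. \<Sum>j\<in>UNIV. \<bar>c i j\<bar>) * norm (transpose (Zmat z t) *v v)"
      by (simp add: sum_distrib_right sum_mono)
  qed
qed

lemma section_coordinates_bound:
  obtains C where "0 \<le> C"
    "\<And>r. norm (Ymat z zt t *v r) \<le> C * (\<Sum>i\<in>UNIV. \<bar>z i t \<bullet> (Ymat z zt t *v r)\<bar>)"
proof (rule that[of "norm (Ymat z zt t)"])
  fix r
  have "norm (Ymat z zt t *v r) \<le> norm (Ymat z zt t) * norm r"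
    by (rule norm_matrix_vector_le)
  also have "\<dots> \<le> norm (Ymat z zt t) * (\<Sum>i\<in>UNIV. \<bar>z i t \<bullet> (Ymat z zt t *v r)\<bar>)"
    by (intro mult_left_mono) (simp_all add: Ymat_dual[OF Zfull_invertible] norm_le_l1_cart)
  finally show "norm (Ymat z zt t *v r)
      \<le> norm (Ymat z zt t) * (\<Sum>i\<in>UNIV. \<bar>z i t \<bullet> (Ymat z zt t *v r)\<bar>)" .
qed simp

end

section \<open>Values of the perturbed solutions at displaced times\<close>

lemma has_vector_derivative_norm_bound:
  fixes u :: "real \<Rightarrow> 'a::real_normed_vector"
  assumes deriv: "\<And>t. t \<in> {a..b} \<Longrightarrow> (u has_vector_derivative u' t) (at t within {a..b})"
    and bound: "\<And>t. t \<in> {a..b} \<Longrightarrow> norm (u' t) \<le> K" and "p \<in> {a..b}" "q \<in> {a..b}"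
  shows "norm (u q - u p) \<le> K * \<bar>q - p\<bar>"
proof -
  have "norm (u q - u p) \<le> K * norm (q - p)"
  proof (rule differentiable_bound[of "{a..b}" u "\<lambda>t h. h *\<^sub>R u' t"])
    show "(u has_derivative (\<lambda>h. h *\<^sub>R u' t)) (at t within {a..b})" if "t \<in> {a..b}" for t
      using deriv[OF that] by (simp add: has_vector_derivative_def)
    show "onorm (\<lambda>h. h *\<^sub>R u' t) \<le> K" if "t \<in> {a..b}" for t
      using bound[OF that] by (intro onorm_le) (simp add: mult.commute[of K] mult_left_mono)
  qed (use assms in auto)
  then show ?thesis by simp
qed

text \<open>
  The path \<open>t \<mapsto> x (s - t \<delta>)\<close>, \<open>0 \<le> t \<le> 1\<close>, has speed at most \<open>\<bar>\<delta>\<bar> K\<close> while it stays in the unit ball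
  around \<open>\<xi>\<close>, and \<open>first_exit\<close> shows that it cannot move far enough to leave that ball.
\<close>
lemma solves_displacement_bound:
  fixes x :: "real \<Rightarrow> 'a::real_normed_vector"
  assumes x: "solves F x"
    and K: "\<And>t v. \<lbrakk>\<bar>t - s\<bar> \<le> 1; norm (v - \<xi>) \<le> 1\<rbrakk> \<Longrightarrow> norm (F t v) \<le> K"
    and near: "norm (x s - \<xi>) \<le> 1 / 2" and \<delta>: "\<bar>\<delta>\<bar> \<le> 1" "\<bar>\<delta>\<bar> * K < 1 / 2"
  shows "norm (x (s - \<delta>) - x s) \<le> \<bar>\<delta>\<bar> * K"
proof -
  define u where "u t = x (s - t * \<delta>)" for t
  have du: "(u has_vector_derivative - \<delta> *\<^sub>R F (s - t * \<delta>) (u t)) (at t within S)" for t S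
  proof -
    have "((\<lambda>t. s - t * \<delta>) has_vector_derivative - \<delta>) (at t within S)"
      by (auto intro!: derivative_eq_intros simp: has_vector_derivative_def)
    moreover have "(x has_vector_derivative F (s - t * \<delta>) (u t))
        (at (s - t * \<delta>) within (\<lambda>t. s - t * \<delta>) ` S)"
      using x unfolding solves_def u_def by (blast intro: has_vector_derivative_at_within)
    ultimately show ?thesis
      using vector_diff_chain_within[of "\<lambda>t. s - t * \<delta>" "- \<delta>" t S x] by (simp add: u_def[abs_def] o_def)
  qed
  have moved: "norm (u b - u 0) \<le> \<bar>\<delta>\<bar> * K"
    if b: "0 \<le> b" "b \<le> 1" and near_u: "\<And>t. \<lbrakk>0 \<le> t; t \<le> b\<rbrakk> \<Longrightarrow> norm (u t - u 0) \<le> 1 / 2" for b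
  proof -
    have speed: "norm (- \<delta> *\<^sub>R F (s - t * \<delta>) (u t)) \<le> \<bar>\<delta>\<bar> * K" if t: "t \<in> {0..b}" for t
    proof -
      have "norm (u t - \<xi>) \<le> norm (u t - u 0) + norm (x s - \<xi>)"
        unfolding u_def by norm
      then have "norm (u t - \<xi>) \<le> 1" using near near_u[of t] t by auto
      moreover have "\<bar>s - t * \<delta> - s\<bar> \<le> 1"
        using t b \<delta>(1) by (simp add: abs_mult mult_le_one)
      ultimately show ?thesis by (simp add: K mult_left_mono)
    qed
    have "norm (u b - u 0) \<le> \<bar>\<delta>\<bar> * K * \<bar>b - 0\<bar>"
      by (rule has_vector_derivative_norm_bound[where a = 0 and b = b, OF du speed]) (use b in auto)
    also have "\<dots> \<le> \<bar>\<delta>\<bar> * K"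
      using b order_trans[OF norm_ge_zero speed[of 0]] by (intro mult_right_le_one_le) auto
    finally show ?thesis .
  qed
  have near_u: "norm (u t - u 0) < 1 / 2" if "t \<in> {0..1}" for t
  proof (rule first_exit[OF _ _ _ that, where \<phi> = "\<lambda>t. norm (u t - u 0)"])
    show "continuous_on {0..1} (\<lambda>t. norm (u t - u 0))"
      by (intro continuous_intros continuous_on_vector_derivative[OF du])
    show "norm (u b - u 0) \<noteq> 1 / 2"
      if "0 \<le> b" "b \<le> 1" "\<And>t. \<lbrakk>0 \<le> t; t \<le> b\<rbrakk> \<Longrightarrow> norm (u t - u 0) \<le> 1 / 2" for b
      using moved[OF that] \<delta>(2) by linarith
  qed simp
  have "norm (u 1 - u 0) \<le> \<bar>\<delta>\<bar> * K"
    using near_u by (intro moved) (auto intro: less_imp_le)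
  then show ?thesis by (simp add: u_def)
qed

text \<open>
  Pointwise convergence of the solutions suffices here, since the common bound \<open>K\<close> on the fields
  makes the solutions equicontinuous near \<open>s\<close>.
\<close>
lemma displaced_solutions_tendsto:
  fixes x :: "nat \<Rightarrow> real \<Rightarrow> 'a::real_normed_vector"
  assumes x: "\<And>k. solves (F k) (x k)"
    and K: "\<And>k t v. \<lbrakk>\<bar>t - s\<bar> \<le> 1; norm (v - \<xi>) \<le> 1\<rbrakk> \<Longrightarrow> norm (F k t v) \<le> K"
    and lim: "(\<lambda>k. x k s) \<longlonglongrightarrow> \<xi>" and \<delta>: "\<delta> \<longlonglongrightarrow> 0"
  shows "(\<lambda>k. x k (s - \<delta> k)) \<longlonglongrightarrow> \<xi>"
proof -
  have \<delta>K: "(\<lambda>k. \<bar>\<delta> k\<bar> * K) \<longlonglongrightarrow> 0"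
    using \<delta> by (auto intro!: tendsto_mult_left_zero tendsto_rabs_zero)
  have "\<forall>\<^sub>F k in sequentially. norm (x k s - \<xi>) < 1 / 2"
    using tendstoD[OF lim, of "1 / 2"] by (simp add: dist_norm)
  moreover have "\<forall>\<^sub>F k in sequentially. \<bar>\<delta> k\<bar> < 1"
    using tendstoD[OF \<delta>, of 1] by simp
  moreover have "\<forall>\<^sub>F k in sequentially. \<bar>\<delta> k\<bar> * K < 1 / 2"
    using order_tendstoD(2)[OF \<delta>K, of "1 / 2"] by simp
  ultimately have "\<forall>\<^sub>F k in sequentially. norm (x k (s - \<delta> k) - x k s) \<le> \<bar>\<delta> k\<bar> * K"
    by eventually_elim (rule solves_displacement_bound[OF x K], auto)
  then have "(\<lambda>k. x k (s - \<delta> k) - x k s) \<longlonglongrightarrow> 0"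
    using \<delta>K by (rule Lim_null_comparison)
  from tendsto_add[OF this lim] show ?thesis by simp
qed

lemma perturbed_field_bounded:
  fixes f :: "real ^ 'n \<Rightarrow> real ^ 'n" and s :: real
  assumes f: "C1_field f"
    and g: "continuous_on (UNIV \<times> UNIV \<times> {0..1}) (\<lambda>(t, v, e). g t v e)"
  obtains K where "\<And>t v e. \<lbrakk>\<bar>t - s\<bar> \<le> 1; norm (v - \<xi>) \<le> 1; e \<in> {0..1}\<rbrakk>
      \<Longrightarrow> norm (f v + e *\<^sub>R g t v e) \<le> K"
proof -
  define Q where "Q = {s - 1..s + 1} \<times> cball \<xi> 1 \<times> {0..1::real}"
  have cf: "continuous_on UNIV f"
    using f unfolding C1_field_def
    by (meson continuous_at_imp_continuous_on differentiable_imp_continuous_within)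
  have "continuous_on Q (\<lambda>p. g (fst p) (fst (snd p)) (snd (snd p)))"
    using continuous_on_subset[OF g, of Q] by (auto simp: Q_def case_prod_unfold)
  then have "continuous_on Q (\<lambda>p. f (fst (snd p))
      + snd (snd p) *\<^sub>R g (fst p) (fst (snd p)) (snd (snd p)))" (is "continuous_on Q ?F")
    by (intro continuous_intros continuous_on_compose2[OF cf]) auto
  moreover have "compact Q" unfolding Q_def by (intro compact_Times) auto
  ultimately have "bounded (?F ` Q)"
    by (intro compact_imp_bounded compact_continuous_image)
  then obtain K where K: "\<And>p. p \<in> Q \<Longrightarrow> norm (?F p) \<le> K"
    by (auto simp: bounded_iff)
  show thesis
  proof (rule that)
    fix t v e assume "\<bar>t - s\<bar> \<le> 1" "norm (v - \<xi>) \<le> 1" "e \<in> {0..1::real}"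
    then have "(t, v, e) \<in> Q"
      by (auto simp: Q_def dist_norm norm_minus_commute abs_le_iff)
    from K[OF this] show "norm (f v + e *\<^sub>R g t v e) \<le> K" by simp
  qed
qed

section \<open>Transversality of the transported section\<close>

context cycle_with_adjoint
begin

text \<open>
  The image of the section under the time-\<open>T\<close> map meets the cycle transversally at \<open>xt \<theta>\<close>, in the
  following quantitative form: for points \<open>xt \<theta> + v\<close> of the image that are close to \<open>xt \<theta>\<close>, the
  components \<open>z i \<theta> \<bullet> v\<close> control all of \<open>v\<close>.

  In the proof, \<open>d\<close> is the difference between the trajectory starting on the section and the one on
  the cycle, so \<open>d T = v\<close>. Backward growth estimates keep \<open>d\<close> of size \<open>O(\<bar>v\<bar>)\<close>. Therefore the
  derivative of \<open>z i (\<theta> + t) \<bullet> d t\<close>, which vanishes to first order in \<open>d\<close>, is at most a small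
  multiple of \<open>\<bar>v\<bar>\<close>. This compares the section coordinates \<open>z i \<theta> \<bullet> d 0\<close> with
  \<open>z i (\<theta> + T) \<bullet> v\<close>, which \<open>shifted_z_bound\<close> estimates by the \<open>z j \<theta> \<bullet> v\<close>. Finally \<open>\<bar>v\<bar>\<close> is bounded
  by the section coordinates through a forward growth estimate.
\<close>
lemma section_transversality:
  assumes flow: "is_flow f T \<Omega>"
  obtains C \<delta> where "0 < \<delta>"
    "\<And>r. norm (Imap \<Omega> T xt z zt \<theta> r - xt \<theta>) < \<delta> \<Longrightarrow>
      norm (Imap \<Omega> T xt z zt \<theta> r - xt \<theta>)
        \<le> C * norm (transpose (Zmat z \<theta>) *v (Imap \<Omega> T xt z zt \<theta> r - xt \<theta>))"
proof -
  define y where "y t = xt (\<theta> + t)" for t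
  define J where "J t = jacobian f (at (y t))" for t
  have shift: "((\<lambda>t. u (\<theta> + t)) has_vector_derivative u') (at t within S)"
    if "(u has_vector_derivative u') (at (\<theta> + t))" for u and u' :: "real ^ 'n" and t S
  proof -
    have "((\<lambda>t. \<theta> + t) has_vector_derivative 1) (at t within S)"
      by (auto intro!: derivative_eq_intros simp: has_vector_derivative_def)
    from vector_diff_chain_within[OF this has_vector_derivative_at_within[OF that]]
    show ?thesis by (simp add: o_def)
  qed
  have dy: "(y has_vector_derivative f (y t)) (at t within S)" for t S
    unfolding y_def using xt(1) by (intro shift) (simp add: solves_def)
  have dz: "((\<lambda>t. z i (\<theta> + t)) has_vector_derivative - (transpose (J t) *v z i (\<theta> + t)))
      (at t within S)" for i t S
    unfolding J_def y_def using z_adjoint[of i]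
    by (intro shift) (simp add: adjoint_solution_def solves_def)
  have y_cont: "continuous_on {0..T} y"
    by (rule continuous_on_vector_derivative[OF dy])
  have compact: "compact (y ` {0..T})"
    by (rule compact_continuous_image[OF y_cont]) simp
  obtain L0 where L0: "0 \<le> L0" "\<And>t. t \<in> {0..T} \<Longrightarrow> norm (J t) \<le> L0"
    unfolding J_def by (rule jacobian_bounded_along[OF f y_cont]) blast
  define L where "L = 1 + L0"
  define E where "E = exp (L * T)"
  have "continuous_on {0..T} (\<lambda>t. \<Sum>i\<in>UNIV. norm (z i (\<theta> + t)))"
    by (intro continuous_intros continuous_on_vector_derivative[OF dz])
  then have "bounded ((\<lambda>t. \<Sum>i\<in>UNIV. norm (z i (\<theta> + t))) ` {0..T})"
    by (intro compact_imp_bounded compact_continuous_image) auto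
  then obtain Cz where Cz: "\<And>t. t \<in> {0..T} \<Longrightarrow> (\<Sum>i\<in>UNIV. norm (z i (\<theta> + t))) \<le> Cz"
    unfolding bounded_iff by (metis abs_le_D1 imageI real_norm_def)
  have z_le: "norm (z i (\<theta> + t)) \<le> Cz" if "t \<in> {0..T}" for i t
    using member_le_sum[of i UNIV "\<lambda>i. norm (z i (\<theta> + t))"] Cz[OF that] by simp
  have "0 \<le> Cz" using order_trans[OF norm_ge_zero z_le[of 0]] T by simp
  obtain B where B: "0 \<le> B" "\<And>r. norm (Ymat z zt \<theta> *v r)
      \<le> B * (\<Sum>i\<in>UNIV. \<bar>z i \<theta> \<bullet> (Ymat z zt \<theta> *v r)\<bar>)"
    using section_coordinates_bound by blast
  obtain N where N: "0 \<le> N"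
    "\<And>v. (\<Sum>i\<in>UNIV. \<bar>z i (\<theta> + T) \<bullet> v\<bar>) \<le> N * norm (transpose (Zmat z \<theta>) *v v)"
    using shifted_z_bound by blast
  \<comment> \<open>In the final estimate the linearization error contributes \<open>P * \<eta> * norm v\<close>; the choice of \<open>\<eta>\<close>
    makes this at most half of \<open>norm v\<close>, so that it can be absorbed.\<close>
  define P where "P = E * B * CARD('m) * Cz * E * T"
  define \<eta> where "\<eta> = 1 / (2 * P + 1)"
  have "0 \<le> P" using \<open>0 \<le> Cz\<close> B T by (simp add: P_def E_def)
  then have \<eta>: "0 < \<eta>" "P * \<eta> \<le> 1 / 2" by (simp_all add: \<eta>_def field_simps)
  \<comment> \<open>The radius \<open>\<rho>1\<close> yields the growth constant \<open>L\<close>, the radius \<open>\<rho>2\<close> the small error \<open>\<eta>\<close>.\<close>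
  obtain \<rho>1 where \<rho>1: "0 < \<rho>1" "\<And>t d. \<lbrakk>t \<in> {0..T}; norm d \<le> \<rho>1\<rbrakk> \<Longrightarrow>
      norm (f (y t + d) - f (y t) - J t *v d) \<le> 1 * norm d"
    using C1_field_uniform_linearization[OF f compact, of 1] unfolding J_def
    by (metis imageI zero_less_one)
  obtain \<rho>2 where \<rho>2: "0 < \<rho>2" "\<And>t d. \<lbrakk>t \<in> {0..T}; norm d \<le> \<rho>2\<rbrakk> \<Longrightarrow>
      norm (f (y t + d) - f (y t) - J t *v d) \<le> \<eta> * norm d"
    using C1_field_uniform_linearization[OF f compact \<eta>(1)] unfolding J_def
    by (metis imageI)
  define \<rho> where "\<rho> = min \<rho>1 \<rho>2"
  have "0 < E" "0 < \<rho>" using \<rho>1 \<rho>2 by (simp_all add: E_def \<rho>_def)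
  show thesis
  proof (rule that[of "\<rho> / E" "2 * (E * B * N)"])
    show "0 < \<rho> / E" using \<open>0 < E\<close> \<open>0 < \<rho>\<close> by simp
    fix r
    define \<xi> where "\<xi> = xt \<theta> + Ymat z zt \<theta> *v r"
    define d where "d t = \<Omega> t 0 \<xi> - y t" for t
    define v where "v = d T"
    have v_eq: "v = Imap \<Omega> T xt z zt \<theta> r - xt \<theta>"
      using xt(2) by (simp add: v_def d_def y_def Imap_def \<xi>_def periodic_def)
    assume "norm (Imap \<Omega> T xt z zt \<theta> r - xt \<theta>) < \<rho> / E"
    then have v_small: "E * norm v < \<rho>"
      using \<open>0 < E\<close> by (simp add: v_eq field_simps)
    have d0: "d 0 = Ymat z zt \<theta> *v r"
      using flow T by (simp add: is_flow_def d_def y_def \<xi>_def)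
    have dd: "(d has_vector_derivative f (y t + d t) - f (y t)) (at t within {0..T})"
      if "t \<in> {0..T}" for t
    proof -
      have "((\<lambda>s. \<Omega> s 0 \<xi>) has_vector_derivative f (\<Omega> t 0 \<xi>)) (at t within {0..T})"
        using flow T that by (simp add: is_flow_def)
      from has_vector_derivative_diff[OF this dy] show ?thesis by (simp add: d_def[abs_def])
    qed
    have growth: "norm (f (y t + d t) - f (y t)) \<le> L * norm (d t)"
      if t: "t \<in> {0..T}" and small: "norm (d t) \<le> \<rho>" for t
    proof -
      have "norm (f (y t + d t) - f (y t))
          \<le> norm (f (y t + d t) - f (y t) - J t *v d t) + norm (J t *v d t)" by norm
      also have "norm (J t *v d t) \<le> L0 * norm (d t)"
        using norm_matrix_vector_le[of "J t" "d t"] L0(2)[OF t]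
        by (meson mult_right_mono norm_ge_zero order_trans)
      finally show ?thesis
        using \<rho>1(2)[OF t, of "d t"] small by (simp add: L_def \<rho>_def algebra_simps)
    qed
    have tube: "norm (d t) < \<rho>" if "t \<in> {0..T}" for t
      by (rule gronwall_backward_tube[OF dd growth])
        (use v_small L0 that in \<open>auto simp: v_def E_def L_def\<close>)
    have compare: "norm (d t) \<le> E * norm (d s)" if "s \<in> {0..T}" "t \<in> {0..T}" for s t
      using gronwall[of 0 T d "\<lambda>t. f (y t + d t) - f (y t)" L s t] dd growth tube that L0
      by (auto simp: E_def L_def less_imp_le)
    have pairing: "\<bar>z i (\<theta> + T) \<bullet> v - z i \<theta> \<bullet> d 0\<bar> \<le> Cz * (\<eta> * (E * norm v)) * T" for i
    proof -
      define h where "h t = z i (\<theta> + t) \<bullet> d t" for t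
      have "norm (h T - h 0) \<le> Cz * (\<eta> * (E * norm v)) * \<bar>T - 0\<bar>"
      proof (rule has_vector_derivative_norm_bound
          [where u' = "\<lambda>t. z i (\<theta> + t) \<bullet> (f (y t + d t) - f (y t) - J t *v d t)"])
        fix t assume t: "t \<in> {0..T}"
        show "(h has_vector_derivative z i (\<theta> + t) \<bullet> (f (y t + d t) - f (y t) - J t *v d t))
            (at t within {0..T})"
          using inner_has_derivative[OF dz dd[OF t]]
          by (simp add: h_def[abs_def] inner_diff_right dot_lmul_matrix)
        have "norm (f (y t + d t) - f (y t) - J t *v d t) \<le> \<eta> * norm (d t)"
          using \<rho>2(2)[OF t, of "d t"] tube[OF t] by (simp add: \<rho>_def)
        also have "\<dots> \<le> \<eta> * (E * norm v)"
          unfolding v_def using compare[of T t] t T \<eta>(1) by (intro mult_left_mono) auto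
        finally show "norm (z i (\<theta> + t) \<bullet> (f (y t + d t) - f (y t) - J t *v d t))
            \<le> Cz * (\<eta> * (E * norm v))"
          using z_le[OF t] \<open>0 \<le> Cz\<close>
          by (auto intro!: order_trans[OF Cauchy_Schwarz_ineq2] mult_mono)
      qed (use T in auto)
      then show ?thesis using T by (simp add: h_def v_def)
    qed
    have "(\<Sum>i\<in>UNIV. \<bar>z i \<theta> \<bullet> d 0\<bar>)
        \<le> (\<Sum>i\<in>(UNIV::'m set). \<bar>z i (\<theta> + T) \<bullet> v\<bar> + Cz * (\<eta> * (E * norm v)) * T)"
    proof (intro sum_mono)
      show "\<bar>z i \<theta> \<bullet> d 0\<bar> \<le> \<bar>z i (\<theta> + T) \<bullet> v\<bar> + Cz * (\<eta> * (E * norm v)) * T" for i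
        using pairing[of i] by linarith
    qed
    also have "\<dots> \<le> N * norm (transpose (Zmat z \<theta>) *v v) + CARD('m) * (Cz * (\<eta> * (E * norm v)) * T)"
      using N(2)[of v] by (simp add: sum.distrib)
    finally have coords: "(\<Sum>i\<in>UNIV. \<bar>z i \<theta> \<bullet> d 0\<bar>)
        \<le> N * norm (transpose (Zmat z \<theta>) *v v) + CARD('m) * (Cz * (\<eta> * (E * norm v)) * T)" .
    have "norm v \<le> E * norm (d 0)"
      unfolding v_def using compare[of 0 T] T by simp
    also have "\<dots> \<le> E * (B * (\<Sum>i\<in>UNIV. \<bar>z i \<theta> \<bullet> d 0\<bar>))"
      unfolding d0 using B(2) \<open>0 < E\<close> by (intro mult_left_mono) auto
    also have "\<dots> \<le> E * (B * (N * norm (transpose (Zmat z \<theta>) *v v)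
        + CARD('m) * (Cz * (\<eta> * (E * norm v)) * T)))"
      using coords B(1) \<open>0 < E\<close> by (intro mult_left_mono) auto
    also have "\<dots> = E * B * N * norm (transpose (Zmat z \<theta>) *v v) + P * \<eta> * norm v"
      by (simp add: P_def algebra_simps)
    also have "P * \<eta> * norm v \<le> 1 / 2 * norm v"
      using \<eta>(2) by (intro mult_right_mono) auto
    finally show "norm (Imap \<Omega> T xt z zt \<theta> r - xt \<theta>) \<le> 2 * (E * B * N)
        * norm (transpose (Zmat z \<theta>) *v (Imap \<Omega> T xt z zt \<theta> r - xt \<theta>))"
      by (simp flip: v_eq)
  qed
qed

end

section \<open>The distance to the cycle\<close>

theorem mainTheorem11:
  fixes T :: real
    and f :: "real ^ 'n \<Rightarrow> real ^ 'n"
    and g :: "real \<Rightarrow> real ^ 'n \<Rightarrow> real \<Rightarrow> real ^ 'n"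
    and \<Omega> :: "real \<Rightarrow> real \<Rightarrow> real ^ 'n \<Rightarrow> real ^ 'n"
    and xt zt :: "real \<Rightarrow> real ^ 'n"
    and z :: "'m::finite \<Rightarrow> real \<Rightarrow> real ^ 'n"
    and \<epsilon> :: "nat \<Rightarrow> real"
    and x :: "nat \<Rightarrow> real \<Rightarrow> real ^ 'n"
    and D :: "real ^ 'm ^ 'm"
    and \<Delta> :: "nat \<Rightarrow> real \<Rightarrow> real"
    and \<theta> :: real
  assumes dim: "CARD('n) = CARD('m) + 1"
    and T: "T > 0"
    and f: "C1_field f"
    and g_cont: "continuous_on (UNIV \<times> UNIV \<times> {0..1}) (\<lambda>(t, v, e). g t v e)"
    and g_per: "\<And>t v e. e \<in> {0..1} \<Longrightarrow> g (t + T) v e = g t v e"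
    and flow: "is_flow f T \<Omega>"
    and xt: "simple_cycle f T xt"
    and adj: "adjoint_system f T xt z zt"
    and eps: "\<And>k. \<epsilon> k \<in> {0<..1}" "\<epsilon> \<longlonglongrightarrow> 0"
    and x_sol: "\<And>k. solves (\<lambda>t v. f v + \<epsilon> k *\<^sub>R g t v (\<epsilon> k)) (x k)"
    and x_per: "\<And>k. periodic T (x k)"
    and x_lim: "\<And>t. (\<lambda>k. x k t) \<longlonglongrightarrow> xt t"
    and D: "invertible D"
    and Delta_lim: "uniform_limit {0..T} \<Delta> (\<lambda>s. 0) sequentially"
    and Delta_I: "\<forall>\<^sub>F k in sequentially. \<forall>s\<in>{0..T}.
        x k (s - \<Delta> k s) \<in> Imap \<Omega> T xt z zt s ` cball 0 1"
    and Delta_asymp: "uniform_limit {0..T}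
        (\<lambda>k s. (1 / \<epsilon> k) *\<^sub>R (transpose (Zmat z s) *v (x k (s - \<Delta> k s) - xt s)
                   - \<epsilon> k *\<^sub>R (D *v Mperp g T xt z s)))
        (\<lambda>s. 0) sequentially"
    and theta: "\<theta> \<in> {0..T}"
    and M_zero: "\<And>i. Mperp g T xt z \<theta> $ i = 0"
  shows "(\<lambda>k. norm (x k (\<theta> - \<Delta> k \<theta>) - xt \<theta>) / \<epsilon> k) \<longlonglongrightarrow> 0"
proof -
  interpret cycle_with_adjoint T f xt zt z
    using xt by unfold_locales (auto simp: simple_cycle_def cycle_def dim T f adj)
  define v where "v k = x k (\<theta> - \<Delta> k \<theta>) - xt \<theta>" for k
  obtain K where K: "\<And>t v e. \<lbrakk>\<bar>t - \<theta>\<bar> \<le> 1; norm (v - xt \<theta>) \<le> 1; e \<in> {0..1}\<rbrakk>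
      \<Longrightarrow> norm (f v + e *\<^sub>R g t v e) \<le> K"
    by (rule perturbed_field_bounded[OF f g_cont]) blast
  have eps01: "\<epsilon> k \<in> {0..1}" for k using eps(1)[of k] by simp
  have "(\<lambda>k. x k (\<theta> - \<Delta> k \<theta>)) \<longlonglongrightarrow> xt \<theta>"
    by (rule displaced_solutions_tendsto[OF x_sol K x_lim tendsto_uniform_limitI[OF Delta_lim theta]])
      (use eps01 in auto)
  then have v_lim: "v \<longlonglongrightarrow> 0" unfolding v_def by (rule LIM_zero)
  obtain C \<delta> where "0 < \<delta>" and C: "\<And>r. norm (Imap \<Omega> T xt z zt \<theta> r - xt \<theta>) < \<delta> \<Longrightarrow>
      norm (Imap \<Omega> T xt z zt \<theta> r - xt \<theta>)
        \<le> C * norm (transpose (Zmat z \<theta>) *v (Imap \<Omega> T xt z zt \<theta> r - xt \<theta>))"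
    by (rule section_transversality[OF flow]) blast
  have "\<forall>\<^sub>F k in sequentially. norm (v k) < \<delta>"
    using tendstoD[OF v_lim \<open>0 < \<delta>\<close>] by simp
  with Delta_I have bound: "\<forall>\<^sub>F k in sequentially.
      norm (norm (v k) / \<epsilon> k) \<le> C * norm ((1 / \<epsilon> k) *\<^sub>R (transpose (Zmat z \<theta>) *v v k))"
  proof eventually_elim
    case (elim k)
    then obtain r where "x k (\<theta> - \<Delta> k \<theta>) = Imap \<Omega> T xt z zt \<theta> r"
      using theta by blast
    then have "norm (v k) \<le> C * norm (transpose (Zmat z \<theta>) *v v k)"
      using C[of r] elim(2) by (simp add: v_def)
    then show ?case using eps(1)[of k] by (simp add: divide_right_mono)
  qed
  have "Mperp g T xt z \<theta> = 0" using M_zero by (simp add: vec_eq_iff)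
  then have "(\<lambda>k. (1 / \<epsilon> k) *\<^sub>R (transpose (Zmat z \<theta>) *v v k)) \<longlonglongrightarrow> 0"
    using tendsto_uniform_limitI[OF Delta_asymp theta] by (simp add: v_def)
  then have "(\<lambda>k. C * norm ((1 / \<epsilon> k) *\<^sub>R (transpose (Zmat z \<theta>) *v v k))) \<longlonglongrightarrow> 0"
    by (intro tendsto_mult_right_zero tendsto_norm_zero)
  from Lim_null_comparison[OF bound this] show ?thesis by (simp add: v_def)
qed

end
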